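(* Let $C_0\in\mathbb{R}\setminus\{0\}$, and consider the Hamiltonian system $\dot g=\{g,\tilde H_C\}$ on the phase space $M$ defined in the context. Fix values of the first integrals $\tilde I_1=C_1>0$, $\tilde I_2=C_2$, $\tilde I_3=C_3$, $\tilde I_4=C_4$, and let $$f(r)=A r^4+B r^2+C,\qquad A=1-\frac{C_0^2}{8C_4},\quad B=1-\frac{C_1}{2C_4}+\frac{(C_2+C_3)C_0}{2C_4},\quad C=-\frac{C_1+(C_2+C_3)^2}{2C_4}.$$ Then the trajectories of the system with these values of the first integrals are of the following two types, i.e. every such trajectory satisfies (i) or (ii): (i) (first type) the trajectory lies outside the hypersphere $r=r_0$, i.e. $r(t)\ge r_0$ for all $t$ in its interval of definition, where $r_0$ is the largest positive root of $f$; (ii) (second type) the trajectory lies between the hyperspheres $r=r_1$ and $r=r_2$, i.e. $r_1\le r(t)\le r_2$ for all $t$ in its interval of definition, where $r_1<r_2$ are positive roots of $f$.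
   Context: The system is the reduced geodesic flow (on the level $\lambda_5=C_0\neq 0$ of the momentum conjugate to the central coordinate) of the left-invariant sub-Riemannian metric on the right-invariant contact distribution of the 5-dimensional Heisenberg group, written in hyperspherical coordinates $x_1=r\cos\theta_1\cos\theta_2$, $y_1=r\cos\theta_1\sin\theta_2$, $x_2=r\sin\theta_1\cos\theta_3$, $y_2=r\sin\theta_1\sin\theta_3$ on $\mathbb{R}^4$. Phase space $M$: points $(r,\theta_1,\theta_2,\theta_3,p_r,p_{\theta_1},p_{\theta_2},p_{\theta_3})$ with $r>0$, $\theta_1\in(0,\pi/2)$, $\theta_2,\theta_3$ angles (mod $2\pi$), and $p_r,p_{\theta_1},p_{\theta_2},p_{\theta_3}\in\mathbb{R}$. Hamiltonian: $$\tilde H_C=\frac12\left[p_r^2+\frac{1}{r^2}p_{\theta_1}^2+\frac1{r^2}\left(\frac{p_{\theta_2}^2}{\cos^2\theta_1}+\frac{p_{\theta_3}^2}{\sin^2\theta_1}\right)-\frac{1}{1+r^2}(p_{\theta_2}+p_{\theta_3})^2\right].$$ Poisson structure (non-canonical): the coordinates $r,\theta_1,\theta_2,\theta_3$ pairwise Poisson-commute, $\{r,p_r\}=1$, $\{r,p_{\theta_k}\}=\{\theta_j,p_r\}=0$, $\{\theta_j,p_{\theta_k}\}=\delta_{jk}$ for $j,k\in\{1,2,3\}$, and $\{p_r,p_{\theta_1}\}=0$, $\{p_r,p_{\theta_2}\}=rC_0\cos^2\theta_1$, $\{p_r,p_{\theta_3}\}=rC_0\sin^2\theta_1$, $\{p_{\theta_1},p_{\theta_2}\}=-\{p_{\theta_1},p_{\theta_3}\}=-r^2C_0\sin\theta_1\cos\theta_1$,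 $\{p_{\theta_2},p_{\theta_3}\}=0$. The Hamiltonian system is $\dot g=\{g,\tilde H_C\}$ for each coordinate function $g$; a trajectory is a solution of it in $M$ on an interval. First integrals (constant along every trajectory): $\tilde I_1=p_{\theta_1}^2+\dfrac{p_{\theta_2}^2}{\cos^2\theta_1}+\dfrac{p_{\theta_3}^2}{\sin^2\theta_1}-(p_{\theta_2}+p_{\theta_3})^2$, $\tilde I_2=p_{\theta_2}+C_0\dfrac{r^2}{2}\cos^2\theta_1$, $\tilde I_3=p_{\theta_3}+C_0\dfrac{r^2}{2}\sin^2\theta_1$, $\tilde I_4=\tilde H_C$. *)

theory Defs
  imports "HOL-Analysis.Analysis"
begin

datatype coord = Rad | Th1 | Th2 | Th3 | PRad | PTh1 | PTh2 | PTh3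

lemma UNIV_coord: "UNIV = {Rad, Th1, Th2, Th3, PRad, PTh1, PTh2, PTh3}"
  using coord.exhaust by auto

instance coord :: finite
  by standard (simp add: UNIV_coord)

text \<open>Angles are represented by real-valued lifts: a trajectory on an interval with circle-valued
  \<open>Th2\<close> and \<open>Th3\<close> has differentiable real lifts of these two coordinates, and neither the
  Hamiltonian, nor the brackets, nor the first integrals depend on them.\<close>

definition phase_space :: "(real^coord) set" where
  "phase_space = {z. 0 < z $ Rad \<and> 0 < z $ Th1 \<and> z $ Th1 < pi / 2}"

definition hamiltonian :: "real^coord \<Rightarrow> real" where
  "hamiltonian z = 1/2 * ((z $ PRad)\<^sup>2 + 1 / (z $ Rad)\<^sup>2 * (z $ PTh1)\<^sup>2
     + 1 / (z $ Rad)\<^sup>2 * ((z $ PTh2)\<^sup>2 / (cos (z $ Th1))\<^sup>2 + (z $ PTh3)\<^sup>2 / (sin (z $ Th1))\<^sup>2)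
     - 1 / (1 + (z $ Rad)\<^sup>2) * (z $ PTh2 + z $ PTh3)\<^sup>2)"

definition integral1 :: "real^coord \<Rightarrow> real" where
  "integral1 z = (z $ PTh1)\<^sup>2 + (z $ PTh2)\<^sup>2 / (cos (z $ Th1))\<^sup>2 + (z $ PTh3)\<^sup>2 / (sin (z $ Th1))\<^sup>2
     - (z $ PTh2 + z $ PTh3)\<^sup>2"

definition integral2 :: "real \<Rightarrow> real^coord \<Rightarrow> real" where
  "integral2 C0 z = z $ PTh2 + C0 * ((z $ Rad)\<^sup>2 / 2) * (cos (z $ Th1))\<^sup>2"

definition integral3 :: "real \<Rightarrow> real^coord \<Rightarrow> real" where
  "integral3 C0 z = z $ PTh3 + C0 * ((z $ Rad)\<^sup>2 / 2) * (sin (z $ Th1))\<^sup>2"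

text \<open>The nonzero brackets \<open>{z\<^sub>i, z\<^sub>j}\<close> with \<open>i\<close> before \<open>j\<close> in the order of the coordinates;
  the remaining ones follow by antisymmetry.\<close>

fun upper_bracket :: "real \<Rightarrow> real^coord \<Rightarrow> coord \<Rightarrow> coord \<Rightarrow> real" where
  "upper_bracket C0 z Rad PRad = 1"
| "upper_bracket C0 z Th1 PTh1 = 1"
| "upper_bracket C0 z Th2 PTh2 = 1"
| "upper_bracket C0 z Th3 PTh3 = 1"
| "upper_bracket C0 z PRad PTh2 = z $ Rad * C0 * (cos (z $ Th1))\<^sup>2"
| "upper_bracket C0 z PRad PTh3 = z $ Rad * C0 * (sin (z $ Th1))\<^sup>2"
| "upper_bracket C0 z PTh1 PTh2 = - ((z $ Rad)\<^sup>2 * C0 * sin (z $ Th1) * cos (z $ Th1))"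
| "upper_bracket C0 z PTh1 PTh3 = (z $ Rad)\<^sup>2 * C0 * sin (z $ Th1) * cos (z $ Th1)"
| "upper_bracket C0 z _ _ = 0"

definition coord_bracket :: "real \<Rightarrow> real^coord \<Rightarrow> coord \<Rightarrow> coord \<Rightarrow> real" where
  "coord_bracket C0 z i j = upper_bracket C0 z i j - upper_bracket C0 z j i"

definition partial_deriv :: "coord \<Rightarrow> (real^coord \<Rightarrow> real) \<Rightarrow> real^coord \<Rightarrow> real" where
  "partial_deriv i F z = deriv (\<lambda>s. F (z + s *\<^sub>R axis i 1)) 0"

definition poisson :: "real \<Rightarrow> (real^coord \<Rightarrow> real) \<Rightarrow> (real^coord \<Rightarrow> real) \<Rightarrow> real^coord \<Rightarrow> real" where
  "poisson C0 F G z =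
     (\<Sum>i\<in>UNIV. \<Sum>j\<in>UNIV. coord_bracket C0 z i j * partial_deriv i F z * partial_deriv j G z)"

definition trajectory :: "real \<Rightarrow> real set \<Rightarrow> (real \<Rightarrow> real^coord) \<Rightarrow> bool" where
  "trajectory C0 T \<gamma> \<longleftrightarrow>
     is_interval T \<and> interior T \<noteq> {} \<and>
     (\<forall>t\<in>T. \<gamma> t \<in> phase_space \<and>
        (\<forall>i. ((\<lambda>s. \<gamma> s $ i) has_real_derivative
               poisson C0 (\<lambda>z. z $ i) hamiltonian (\<gamma> t)) (at t within T)))"

end

theory Submission
  imports Defs
begin

text \<open>
  The radial motion is a one-dimensional motion in an effective potential. Write
  \<open>P = p\<^sub>\<theta>\<^sub>2 + p\<^sub>\<theta>\<^sub>3\<close>. The angular part of the Hamiltonian is a function of \<open>r\<close>, \<open>I\<^sub>1\<close> and \<open>P\<close>: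
  \<open>2 H = p\<^sub>r\<^sup>2 + (I\<^sub>1 + P\<^sup>2) / r\<^sup>2 - P\<^sup>2 / (1 + r\<^sup>2)\<close>. Since \<open>cos\<^sup>2 + sin\<^sup>2 = 1\<close>, the sum
  \<open>I\<^sub>2 + I\<^sub>3\<close> equals \<open>P + C\<^sub>0 r\<^sup>2 / 2\<close>, so \<open>P\<close> is itself a function of \<open>r\<close> on a common level of the
  first integrals. Clearing denominators gives the radial equation
  \<open>r\<^sup>2 (1 + r\<^sup>2) p\<^sub>r\<^sup>2 = 2 C\<^sub>4 f(r)\<close> (lemma \<open>radial_equation\<close>). It forces \<open>C\<^sub>4 > 0\<close> because
  \<open>C\<^sub>1 > 0\<close>, and then \<open>f(r) \<ge> 0\<close> along the whole trajectory.

  That the level does not change in time is the chain rule \<open>d/dt F(\<gamma>) = {F, H}\<close> (lemma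
  \<open>trajectory_has_derivative_poisson\<close>) together with the vanishing of the four brackets: for \<open>H\<close>
  by antisymmetry, for the other three by computing gradients.

  What remains concerns a quadratic \<open>q\<close> in \<open>u = r\<^sup>2\<close> with \<open>q(0) = C < 0\<close> that is nonnegative at
  some positive point (lemma \<open>quadratic_nonneg_region\<close>). It has a positive root \<open>a\<close>, and
  \<open>a q(u) = (u - a) (A a u - C)\<close>. If \<open>A \<ge> 0\<close>, the second factor is positive for \<open>u > 0\<close>, so
  \<open>q(u) \<ge> 0\<close> means \<open>u \<ge> a\<close>: the first type. If \<open>A < 0\<close>, it has the positive root \<open>b = C / (A a)\<close>,
  and \<open>q(u) \<ge> 0\<close> means that \<open>u\<close> lies between \<open>a\<close> and \<open>b\<close>: the second type if \<open>a \<noteq> b\<close>. If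
  \<open>a = b\<close> the radius is constant and equal to the only positive root of \<open>f\<close>, which is a degenerate
  instance of the first type.
\<close>

section \<open>First integrals are constant along trajectories\<close>

lemma partial_deriv_eq_derivative:
  assumes "(F has_derivative F') (at z)"
  shows "partial_deriv i F z = F' (axis i 1)"
proof -
  have "((\<lambda>s. F (z + s *\<^sub>R axis i 1)) has_derivative (\<lambda>s. F' (s *\<^sub>R axis i 1))) (at 0)"
    by (rule has_derivative_compose[where g = F and g' = F' and f = "\<lambda>s. z + s *\<^sub>R axis i 1"])
      (use assms in \<open>auto intro!: derivative_eq_intros\<close>)
  moreover have "F' (s *\<^sub>R axis i 1) = F' (axis i 1) * s" for s
    using linear_cmul[OF has_derivative_linear[OF assms]] by simp
  ultimately have "((\<lambda>s. F (z + s *\<^sub>R axis i 1)) has_real_derivative F' (axis i 1)) (at 0)"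
    by (simp add: has_field_derivative_def)
  then show ?thesis
    unfolding partial_deriv_def by (rule DERIV_imp_deriv)
qed

lemma derivative_eq_sum_partial_deriv:
  assumes "(F has_derivative F') (at z)"
  shows "F' v = (\<Sum>i\<in>UNIV. v $ i * partial_deriv i F z)"
proof -
  have lin: "linear F'"
    using assms by (rule has_derivative_linear)
  have "F' v = F' (\<Sum>i\<in>UNIV. v $ i *\<^sub>R axis i 1)"
    by (simp add: basis_expansion flip: scalar_mult_eq_scaleR)
  also have "\<dots> = (\<Sum>i\<in>UNIV. v $ i * partial_deriv i F z)"
    by (simp add: linear_sum[OF lin] linear_cmul[OF lin] partial_deriv_eq_derivative[OF assms])
  finally show ?thesis .
qed

lemma partial_deriv_component:
  "partial_deriv i (\<lambda>z. z $ k) z = (if i = k then 1 else 0)"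
proof -
  have "((\<lambda>z. z $ k) has_derivative (\<lambda>v. v $ k)) (at z)"
    by (rule bounded_linear_imp_has_derivative) (rule bounded_linear_vec_nth)
  from partial_deriv_eq_derivative[OF this, of i] show ?thesis
    by (simp add: axis_def)
qed

lemma poisson_component:
  "poisson C0 (\<lambda>z. z $ i) G z = (\<Sum>j\<in>UNIV. coord_bracket C0 z i j * partial_deriv j G z)"
proof -
  have "poisson C0 (\<lambda>z. z $ i) G z
      = (\<Sum>k\<in>UNIV. if k = i then \<Sum>j\<in>UNIV. coord_bracket C0 z k j * partial_deriv j G z else 0)"
    unfolding poisson_def by (intro sum.cong) (auto simp: partial_deriv_component)
  then show ?thesis by simp
qed

text \<open>By the chain rule, the gradient of an observable is contracted with the velocity, and the
  equations of motion turn this into the bracket with the Hamiltonian.\<close>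

lemma trajectory_has_derivative_poisson:
  assumes "trajectory C0 T \<gamma>" "t \<in> T" "F differentiable (at (\<gamma> t))"
  shows "((\<lambda>s. F (\<gamma> s)) has_real_derivative poisson C0 F hamiltonian (\<gamma> t)) (at t within T)"
proof -
  obtain F' where F': "(F has_derivative F') (at (\<gamma> t))"
    using assms(3) unfolding differentiable_def by blast
  define v :: "real^coord" where "v = (\<chi> i. poisson C0 (\<lambda>z. z $ i) hamiltonian (\<gamma> t))"
  have "(\<gamma> has_derivative (\<lambda>h. h *\<^sub>R v)) (at t within T)"
    unfolding has_derivative_componentwise_within[of \<gamma>]
  proof
    fix b :: "real^coord" assume "b \<in> Basis"
    then obtain i where b: "b = axis i 1"
      by (auto simp: Basis_vec_def)
    have rhs: "(\<lambda>h. h *\<^sub>R v \<bullet> b) = (*) (v $ i)"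
      by (auto simp: b inner_axis)
    have "((\<lambda>s. \<gamma> s $ i) has_real_derivative v $ i) (at t within T)"
      using assms(1,2) by (simp add: trajectory_def v_def)
    then show "((\<lambda>s. \<gamma> s \<bullet> b) has_derivative (\<lambda>h. h *\<^sub>R v \<bullet> b)) (at t within T)"
      unfolding rhs by (simp add: b inner_axis has_field_derivative_def)
  qed
  from has_derivative_compose[OF this F']
  have "((\<lambda>s. F (\<gamma> s)) has_real_derivative F' v) (at t within T)"
    by (simp add: has_field_derivative_def linear_cmul[OF has_derivative_linear[OF F']]
        mult_commute_abs)
  moreover have "F' v = poisson C0 F hamiltonian (\<gamma> t)"
    unfolding derivative_eq_sum_partial_deriv[OF F'] poisson_def
    by (simp add: v_def poisson_component sum_distrib_left mult_ac)
  ultimately show ?thesis by simp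
qed

lemma first_integral_constant:
  assumes "trajectory C0 T \<gamma>" "t \<in> T" "t0 \<in> T"
    and "\<And>z. z \<in> phase_space \<Longrightarrow> F differentiable (at z)"
    and "\<And>z. z \<in> phase_space \<Longrightarrow> poisson C0 F hamiltonian z = 0"
  shows "F (\<gamma> t) = F (\<gamma> t0)"
proof -
  have "convex T"
    using assms(1) by (simp add: trajectory_def is_interval_convex)
  moreover have "((\<lambda>s. F (\<gamma> s)) has_real_derivative 0) (at s within T)" if "s \<in> T" for s
  proof -
    have "\<gamma> s \<in> phase_space"
      using assms(1) that by (simp add: trajectory_def)
    then show ?thesis
      using trajectory_has_derivative_poisson[OF assms(1) that] assms(4,5) by metis
  qed
  ultimately show ?thesis
    using has_field_derivative_zero_constant[of T "\<lambda>s. F (\<gamma> s)"] assms(2,3) by metis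
qed

section \<open>The four functions Poisson-commute with the Hamiltonian\<close>

lemma phase_space_pos:
  assumes "z \<in> phase_space"
  shows "z $ Rad > 0" "cos (z $ Th1) > 0" "sin (z $ Th1) > 0"
    "1 + (z $ Rad)\<^sup>2 > 0"
  using assms by (auto simp: phase_space_def intro!: cos_gt_zero sin_gt_zero add_pos_pos)

lemma has_derivative_vec_component [derivative_intros]:
  "((\<lambda>z::real^coord. z $ i) has_derivative (\<lambda>v. v $ i)) (at z)"
  by (rule bounded_linear_imp_has_derivative) (rule bounded_linear_vec_nth)

lemma hamiltonian_differentiable:
  assumes "z \<in> phase_space"
  shows "hamiltonian differentiable (at z)"
  using phase_space_pos[OF assms] unfolding differentiable_def hamiltonian_def
  by (intro exI) (rule derivative_eq_intros refl | simp)+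

lemma integral1_differentiable:
  assumes "z \<in> phase_space"
  shows "integral1 differentiable (at z)"
  using phase_space_pos[OF assms] unfolding differentiable_def integral1_def
  by (intro exI) (rule derivative_eq_intros refl | simp)+

lemma integral2_differentiable: "integral2 C0 differentiable (at z)"
  unfolding differentiable_def integral2_def
  by (intro exI) (rule derivative_eq_intros refl | simp)+

lemma integral3_differentiable: "integral3 C0 differentiable (at z)"
  unfolding differentiable_def integral3_def
  by (intro exI) (rule derivative_eq_intros refl | simp)+

lemma poisson_self: "poisson C0 F F z = 0"
proof -
  let ?p = "\<lambda>i. partial_deriv i F z"
  have "poisson C0 F F z = (\<Sum>j\<in>UNIV. \<Sum>i\<in>UNIV. coord_bracket C0 z i j * ?p i * ?p j)"
    unfolding poisson_def by (rule sum.swap)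
  also have "\<dots> = (\<Sum>j\<in>UNIV. \<Sum>i\<in>UNIV. - (coord_bracket C0 z j i * ?p j * ?p i))"
    by (simp add: coord_bracket_def algebra_simps)
  also have "\<dots> = - poisson C0 F F z"
    by (simp add: poisson_def sum_negf)
  finally show ?thesis by simp
qed

lemma hamiltonian_gradient:
  assumes "z \<in> phase_space"
  shows "partial_deriv Th1 hamiltonian z =
      ((z $ PTh2)\<^sup>2 * sin (z $ Th1) / cos (z $ Th1) ^ 3
        - (z $ PTh3)\<^sup>2 * cos (z $ Th1) / sin (z $ Th1) ^ 3) / (z $ Rad)\<^sup>2"
    and "partial_deriv Th2 hamiltonian z = 0"
    and "partial_deriv Th3 hamiltonian z = 0"
    and "partial_deriv PRad hamiltonian z = z $ PRad"
    and "partial_deriv PTh1 hamiltonian z = z $ PTh1 / (z $ Rad)\<^sup>2"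
    and "partial_deriv PTh2 hamiltonian z =
      z $ PTh2 / ((z $ Rad)\<^sup>2 * (cos (z $ Th1))\<^sup>2) - (z $ PTh2 + z $ PTh3) / (1 + (z $ Rad)\<^sup>2)"
    and "partial_deriv PTh3 hamiltonian z =
      z $ PTh3 / ((z $ Rad)\<^sup>2 * (sin (z $ Th1))\<^sup>2) - (z $ PTh2 + z $ PTh3) / (1 + (z $ Rad)\<^sup>2)"
  by (unfold partial_deriv_def hamiltonian_def, insert phase_space_pos[OF assms];
      rule DERIV_imp_deriv, auto simp: axis_def intro!: derivative_eq_intros;
      simp add: field_simps power2_eq_square power3_eq_cube power4_eq_xxxx)+

lemma integral1_gradient:
  assumes "z \<in> phase_space"
  shows "partial_deriv Rad integral1 z = 0"
    and "partial_deriv Th1 integral1 z =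
      2 * ((z $ PTh2)\<^sup>2 * sin (z $ Th1) / cos (z $ Th1) ^ 3
        - (z $ PTh3)\<^sup>2 * cos (z $ Th1) / sin (z $ Th1) ^ 3)"
    and "partial_deriv Th2 integral1 z = 0"
    and "partial_deriv Th3 integral1 z = 0"
    and "partial_deriv PRad integral1 z = 0"
    and "partial_deriv PTh1 integral1 z = 2 * z $ PTh1"
    and "partial_deriv PTh2 integral1 z =
      2 * z $ PTh2 / (cos (z $ Th1))\<^sup>2 - 2 * (z $ PTh2 + z $ PTh3)"
    and "partial_deriv PTh3 integral1 z =
      2 * z $ PTh3 / (sin (z $ Th1))\<^sup>2 - 2 * (z $ PTh2 + z $ PTh3)"
  by (unfold partial_deriv_def integral1_def, insert phase_space_pos[OF assms];
      rule DERIV_imp_deriv, auto simp: axis_def intro!: derivative_eq_intros;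
      simp add: field_simps power2_eq_square power3_eq_cube power4_eq_xxxx)+

lemma integral2_gradient:
  shows "partial_deriv Rad (integral2 C0) z = C0 * z $ Rad * (cos (z $ Th1))\<^sup>2"
    and "partial_deriv Th1 (integral2 C0) z = - (C0 * (z $ Rad)\<^sup>2 * cos (z $ Th1) * sin (z $ Th1))"
    and "partial_deriv Th2 (integral2 C0) z = 0"
    and "partial_deriv Th3 (integral2 C0) z = 0"
    and "partial_deriv PRad (integral2 C0) z = 0"
    and "partial_deriv PTh1 (integral2 C0) z = 0"
    and "partial_deriv PTh2 (integral2 C0) z = 1"
    and "partial_deriv PTh3 (integral2 C0) z = 0"
  by (unfold partial_deriv_def integral2_def;
      rule DERIV_imp_deriv, auto simp: axis_def intro!: derivative_eq_intros)+

lemma integral3_gradient: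
  shows "partial_deriv Rad (integral3 C0) z = C0 * z $ Rad * (sin (z $ Th1))\<^sup>2"
    and "partial_deriv Th1 (integral3 C0) z = C0 * (z $ Rad)\<^sup>2 * cos (z $ Th1) * sin (z $ Th1)"
    and "partial_deriv Th2 (integral3 C0) z = 0"
    and "partial_deriv Th3 (integral3 C0) z = 0"
    and "partial_deriv PRad (integral3 C0) z = 0"
    and "partial_deriv PTh1 (integral3 C0) z = 0"
    and "partial_deriv PTh2 (integral3 C0) z = 0"
    and "partial_deriv PTh3 (integral3 C0) z = 1"
  by (unfold partial_deriv_def integral3_def;
      rule DERIV_imp_deriv, auto simp: axis_def intro!: derivative_eq_intros)+

text \<open>The magnetic brackets make \<open>p\<^sub>\<theta>\<^sub>2\<close> and \<open>p\<^sub>\<theta>\<^sub>3\<close> change at exactly the rates at which the added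
  terms \<open>C\<^sub>0 r\<^sup>2 cos\<^sup>2 \<theta>\<^sub>1 / 2\<close> and \<open>C\<^sub>0 r\<^sup>2 sin\<^sup>2 \<theta>\<^sub>1 / 2\<close> change with the opposite sign.\<close>

lemma poisson_integral2:
  assumes "z \<in> phase_space"
  shows "poisson C0 (integral2 C0) hamiltonian z = 0"
  using phase_space_pos[OF assms]
  by (simp add: poisson_def UNIV_coord coord_bracket_def integral2_gradient
      hamiltonian_gradient[OF assms])

lemma poisson_integral3:
  assumes "z \<in> phase_space"
  shows "poisson C0 (integral3 C0) hamiltonian z = 0"
  using phase_space_pos[OF assms]
  by (simp add: poisson_def UNIV_coord coord_bracket_def integral3_gradient
      hamiltonian_gradient[OF assms])

text \<open>The dependence of \<open>I\<^sub>1\<close> and \<open>H\<close> on \<open>\<theta>\<^sub>1\<close> and \<open>p\<^sub>\<theta>\<^sub>1\<close> is proportional, with factor \<open>2 r\<^sup>2\<close>,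
  so their canonical bracket vanishes. The same proportionality, up to a common shift of the
  derivatives in \<open>p\<^sub>\<theta>\<^sub>2\<close> and \<open>p\<^sub>\<theta>\<^sub>3\<close>, kills the contribution of the brackets of \<open>p\<^sub>\<theta>\<^sub>1\<close>, which are
  opposite to each other. The brackets of \<open>p\<^sub>r\<close> contribute a multiple of
  \<open>p\<^sub>\<theta>\<^sub>2 + p\<^sub>\<theta>\<^sub>3 - (cos\<^sup>2 \<theta>\<^sub>1 + sin\<^sup>2 \<theta>\<^sub>1) P = 0\<close>.\<close>

lemma poisson_integral1:
  assumes "z \<in> phase_space"
  shows "poisson C0 integral1 hamiltonian z = 0"
proof -
  define r c s a b P where "r = z $ Rad" and "c = cos (z $ Th1)" and "s = sin (z $ Th1)"
    and "a = z $ PTh2 / c\<^sup>2" and "b = z $ PTh3 / s\<^sup>2" and "P = z $ PTh2 + z $ PTh3"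
  define g where "g = (z $ PTh2)\<^sup>2 * s / c ^ 3 - (z $ PTh3)\<^sup>2 * c / s ^ 3"
  define w e where "w = 1 / r\<^sup>2" and "e = P / (1 + r\<^sup>2)"
  note pos = phase_space_pos[OF assms, folded r_def c_def s_def]
  have ab: "c\<^sup>2 * a + s\<^sup>2 * b = P" "c\<^sup>2 + s\<^sup>2 = 1"
    using pos by (simp_all add: a_def b_def P_def) (simp add: c_def s_def)
  have grad1:
    "partial_deriv Th1 integral1 z = 2 * g"
    "partial_deriv PTh1 integral1 z = 2 * z $ PTh1"
    "partial_deriv PTh2 integral1 z = 2 * (a - P)"
    "partial_deriv PTh3 integral1 z = 2 * (b - P)"
    using integral1_gradient[OF assms] by (simp_all add: g_def a_def b_def P_def c_def s_def)
  have gradH: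
    "partial_deriv Th1 hamiltonian z = g * w"
    "partial_deriv PTh1 hamiltonian z = z $ PTh1 * w"
    "partial_deriv PTh2 hamiltonian z = a * w - e"
    "partial_deriv PTh3 hamiltonian z = b * w - e"
    using hamiltonian_gradient[OF assms]
    by (simp_all add: g_def a_def b_def P_def c_def s_def r_def w_def e_def mult.commute)
  have "poisson C0 integral1 hamiltonian z =
      2 * g * (z $ PTh1 * w) - 2 * z $ PTh1 * (g * w)
      - 2 * r * C0 * z $ PRad * (c\<^sup>2 * (a - P) + s\<^sup>2 * (b - P))
      - r\<^sup>2 * C0 * s * c *
        (2 * z $ PTh1 * ((a * w - e) - (b * w - e))
         - 2 * ((a - P) - (b - P)) * (z $ PTh1 * w))"
    unfolding poisson_def UNIV_coord
    by (simp add: coord_bracket_def integral1_gradient(1,3-5)[OF assms] grad1 gradH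
        hamiltonian_gradient(2-4)[OF assms] flip: r_def c_def s_def) algebra
  also have "\<dots> = - 2 * r * C0 * z $ PRad * (c\<^sup>2 * (a - P) + s\<^sup>2 * (b - P))"
    by (simp add: algebra_simps)
  also have "c\<^sup>2 * (a - P) + s\<^sup>2 * (b - P) = (c\<^sup>2 * a + s\<^sup>2 * b) - (c\<^sup>2 + s\<^sup>2) * P"
    by (simp add: algebra_simps)
  also have "\<dots> = 0"
    by (simp add: ab)
  finally show ?thesis by simp
qed

section \<open>The radial equation and its allowed region\<close>

text \<open>The right-hand side depends on the point only through \<open>r\<close> and the first integrals, which
  confines \<open>r\<close> to the region where it is nonnegative.\<close>

lemma radial_equation:
  assumes "z \<in> phase_space"
  shows "(z $ Rad)\<^sup>2 * (1 + (z $ Rad)\<^sup>2) * (z $ PRad)\<^sup>2 =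
    2 * hamiltonian z * ((z $ Rad)\<^sup>2 * (1 + (z $ Rad)\<^sup>2)) - integral1 z * (1 + (z $ Rad)\<^sup>2)
      - (integral2 C0 z + integral3 C0 z - C0 / 2 * (z $ Rad)\<^sup>2)\<^sup>2"
proof -
  define r p P I c s where "r = z $ Rad" and "p = z $ PRad" and "P = z $ PTh2 + z $ PTh3"
    and "I = integral1 z" and "c = cos (z $ Th1)" and "s = sin (z $ Th1)"
  have r: "r > 0" and r1: "1 + r\<^sup>2 > 0"
    using phase_space_pos(1,4)[OF assms] by (simp_all add: r_def)
  have "hamiltonian z = 1/2 * (p\<^sup>2 + (I + P\<^sup>2) / r\<^sup>2 - P\<^sup>2 / (1 + r\<^sup>2))"
    unfolding hamiltonian_def integral1_def I_def r_def p_def P_def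
    by (simp add: add_divide_distrib)
  then have "2 * hamiltonian z = p\<^sup>2 + (I + P\<^sup>2) / r\<^sup>2 - P\<^sup>2 / (1 + r\<^sup>2)"
    by simp
  moreover have "(I + P\<^sup>2) / r\<^sup>2 * r\<^sup>2 = I + P\<^sup>2" "P\<^sup>2 / (1 + r\<^sup>2) * (1 + r\<^sup>2) = P\<^sup>2"
    using r r1 by simp_all
  ultimately have "2 * hamiltonian z * (r\<^sup>2 * (1 + r\<^sup>2)) = r\<^sup>2 * (1 + r\<^sup>2) * p\<^sup>2 + I * (1 + r\<^sup>2) + P\<^sup>2"
    by algebra
  moreover have "integral2 C0 z + integral3 C0 z - C0 / 2 * r\<^sup>2 = P"
  proof -
    have "integral2 C0 z + integral3 C0 z = P + C0 * (r\<^sup>2 / 2) * (c\<^sup>2 + s\<^sup>2)"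
      unfolding integral2_def integral3_def P_def r_def c_def s_def by algebra
    then show ?thesis by (simp add: c_def s_def)
  qed
  ultimately show ?thesis
    unfolding r_def[symmetric] p_def[symmetric] I_def[symmetric] by simp
qed

text \<open>The root \<open>a\<close> between \<open>0\<close> and \<open>s\<close> splits off a linear factor, and multiplying by \<open>a\<close> expresses the
  cofactor without \<open>B\<close>, so that the sign of \<open>A\<close> decides whether it has a zero at some \<open>u > 0\<close>. A
  double root falls under the first alternative: no other point has \<open>q\<close> nonnegative.\<close>

lemma quadratic_nonneg_region:
  fixes A B C s :: real
  defines "q \<equiv> \<lambda>u. A * u\<^sup>2 + B * u + C"
  assumes "C < 0" "s > 0" "q s \<ge> 0"
  shows "(\<exists>u0>0. q u0 = 0 \<and> (\<forall>u>0. q u = 0 \<longrightarrow> u \<le> u0) \<and> (\<forall>u>0. q u \<ge> 0 \<longrightarrow> u0 \<le> u))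
    \<or> (\<exists>u1 u2. 0 < u1 \<and> u1 < u2 \<and> q u1 = 0 \<and> q u2 = 0 \<and> (\<forall>u>0. q u \<ge> 0 \<longrightarrow> u1 \<le> u \<and> u \<le> u2))"
proof -
  have q0: "q 0 < 0"
    using assms(2) by (simp add: q_def)
  have "\<exists>u\<ge>0. u \<le> s \<and> q u = 0"
    using q0 assms(3,4) by (intro IVT') (auto simp: q_def intro!: continuous_intros)
  then obtain a where "a \<ge> 0" and qa: "q a = 0" by blast
  with q0 have a: "a > 0" by (cases "a = 0") auto
  have factor: "a * q u = (u - a) * (A * a * u - C)" for u
  proof -
    have "B * a = - C - A * a\<^sup>2"
      using qa by (simp add: q_def)
    moreover have "a * q u = A * a * u\<^sup>2 + (B * a) * u + C * a"
      by (simp add: q_def algebra_simps)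
    ultimately show ?thesis by algebra
  qed
  have nonneg_iff: "q u \<ge> 0 \<longleftrightarrow> (u - a) * (A * a * u - C) \<ge> 0" for u
    using a by (simp flip: factor add: zero_le_mult_iff)
  have zero_iff: "q u = 0 \<longleftrightarrow> (u - a) * (A * a * u - C) = 0" for u
    using a by (simp flip: factor)
  show ?thesis
  proof (cases "A \<ge> 0")
    case True
    then have "A * a * u - C > 0" if "u > 0" for u
      using a that \<open>C < 0\<close> by (smt (verit) mult_nonneg_nonneg)
    then have "q u \<ge> 0 \<longleftrightarrow> a \<le> u" "q u = 0 \<longleftrightarrow> u = a" if "u > 0" for u
      using that by (fastforce simp: nonneg_iff zero_iff zero_le_mult_iff)+
    then show ?thesis using a qa by auto
  next
    case False
    define b where "b = C / (A * a)"
    have Aa: "A * a < 0" using False a by (simp add: mult_neg_pos)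
    then have b: "b > 0" using \<open>C < 0\<close> by (simp add: b_def divide_neg_neg)
    have "A * a * b = C" using False a by (auto simp: b_def)
    then have "A * a * u - C = A * a * (u - b)" for u
      by (simp add: algebra_simps)
    then have eq: "(u - a) * (A * a * u - C) = A * a * ((u - a) * (u - b))" for u
      by (simp add: algebra_simps)
    have zero: "q u = 0 \<longleftrightarrow> u = a \<or> u = b" for u
      using Aa by (auto simp: zero_iff eq)
    have nonneg: "q u \<ge> 0 \<longleftrightarrow> (u - a) * (u - b) \<le> 0" for u
      using Aa unfolding nonneg_iff eq zero_le_mult_iff[of "A * a"] by auto
    then have nonnegD: "min a b \<le> u \<and> u \<le> max a b" if "q u \<ge> 0" for u
      using that by (auto simp: mult_le_0_iff)
    show ?thesis
    proof (cases "a = b")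
      case True
      \<comment> \<open>Here \<open>q\<close> is nonnegative at \<open>a\<close> only.\<close>
      then show ?thesis using a zero nonnegD by auto
    next
      case False
      then have "0 < min a b \<and> min a b < max a b \<and> q (min a b) = 0 \<and> q (max a b) = 0"
        using a b by (auto simp: zero min_def max_def)
      then show ?thesis using nonnegD by blast
    qed
  qed
qed

theorem theorem3p1:
  fixes C0 C1 C2 C3 C4 A B C :: real
    and f :: "real \<Rightarrow> real"
    and T :: "real set"
    and \<gamma> :: "real \<Rightarrow> real^coord"
    and t0 :: real
  assumes "C0 \<noteq> 0"
    and "C1 > 0"
    and "A = 1 - C0\<^sup>2 / (8 * C4)"
    and "B = 1 - C1 / (2 * C4) + (C2 + C3) * C0 / (2 * C4)"
    and "C = - ((C1 + (C2 + C3)\<^sup>2) / (2 * C4))"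
    and "f = (\<lambda>r. A * r ^ 4 + B * r\<^sup>2 + C)"
    and "trajectory C0 T \<gamma>"
    and "t0 \<in> T"
    and "integral1 (\<gamma> t0) = C1"
    and "integral2 C0 (\<gamma> t0) = C2"
    and "integral3 C0 (\<gamma> t0) = C3"
    and "hamiltonian (\<gamma> t0) = C4"
  shows "(\<exists>r0. r0 > 0 \<and> f r0 = 0 \<and> (\<forall>r>0. f r = 0 \<longrightarrow> r \<le> r0)
              \<and> (\<forall>t\<in>T. \<gamma> t $ Rad \<ge> r0))
       \<or> (\<exists>r1 r2. 0 < r1 \<and> r1 < r2 \<and> f r1 = 0 \<and> f r2 = 0
              \<and> (\<forall>t\<in>T. r1 \<le> \<gamma> t $ Rad \<and> \<gamma> t $ Rad \<le> r2))"
proof -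
  define K where "K = C2 + C3"
  have phase: "\<gamma> t \<in> phase_space" if "t \<in> T" for t
    using assms(7) that by (simp add: trajectory_def)
  have radial: "(\<gamma> t $ Rad)\<^sup>2 * (1 + (\<gamma> t $ Rad)\<^sup>2) * (\<gamma> t $ PRad)\<^sup>2 =
      2 * C4 * ((\<gamma> t $ Rad)\<^sup>2 * (1 + (\<gamma> t $ Rad)\<^sup>2)) - C1 * (1 + (\<gamma> t $ Rad)\<^sup>2)
        - (K - C0 / 2 * (\<gamma> t $ Rad)\<^sup>2)\<^sup>2" if t: "t \<in> T" for t
  proof -
    note const = first_integral_constant[OF assms(7) t assms(8)]
    have "integral1 (\<gamma> t) = C1"
      using const[of integral1] integral1_differentiable poisson_integral1 assms(9) by simp
    moreover have "integral2 C0 (\<gamma> t) = C2"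
      using const[of "integral2 C0"] integral2_differentiable poisson_integral2 assms(10) by simp
    moreover have "integral3 C0 (\<gamma> t) = C3"
      using const[of "integral3 C0"] integral3_differentiable poisson_integral3 assms(11) by simp
    moreover have "hamiltonian (\<gamma> t) = C4"
      using const[of hamiltonian] hamiltonian_differentiable poisson_self assms(12) by simp
    ultimately show ?thesis
      using radial_equation[OF phase[OF t], of C0] by (simp add: K_def)
  qed
  have rad_pos: "\<gamma> t $ Rad > 0" if "t \<in> T" for t
    using phase_space_pos(1)[OF phase[OF that]] .
  \<comment> \<open>The radial equation writes \<open>C\<^sub>4\<close>, up to a positive factor, as a sum of nonnegative terms and a
    positive multiple of \<open>C\<^sub>1\<close>.\<close>
  have C4: "C4 > 0"
  proof -
    let ?w = "(\<gamma> t0 $ Rad)\<^sup>2"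
    have w: "?w > 0" using rad_pos[OF assms(8)] by simp
    have "C1 * (1 + ?w) > 0" "?w * (1 + ?w) * (\<gamma> t0 $ PRad)\<^sup>2 \<ge> 0"
      "(K - C0 / 2 * ?w)\<^sup>2 \<ge> 0"
      using w assms(2) by (auto intro!: mult_nonneg_nonneg mult_pos_pos add_pos_pos)
    then have "2 * C4 * (?w * (1 + ?w)) > 0"
      using radial[OF assms(8)] by linarith
    moreover have "?w * (1 + ?w) > 0"
      using w by (intro mult_pos_pos add_pos_pos) simp_all
    ultimately have "2 * C4 > 0"
      by (rule zero_less_mult_pos2)
    then show ?thesis by simp
  qed
  define q where "q = (\<lambda>u. A * u\<^sup>2 + B * u + C)"
  have fq: "f r = q (r\<^sup>2)" for r
    by (simp add: assms(6) q_def flip: power_mult)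
  have q: "2 * C4 * q u = 2 * C4 * (u * (1 + u)) - C1 * (1 + u) - (K - C0 / 2 * u)\<^sup>2" for u
    using C4 unfolding q_def assms(3-5) K_def by (simp add: field_simps power2_eq_square)
  have q_nonneg: "q ((\<gamma> t $ Rad)\<^sup>2) \<ge> 0" if "t \<in> T" for t
  proof -
    have "2 * C4 * q ((\<gamma> t $ Rad)\<^sup>2) = (\<gamma> t $ Rad)\<^sup>2 * (1 + (\<gamma> t $ Rad)\<^sup>2) * (\<gamma> t $ PRad)\<^sup>2"
      using q radial[OF that] by simp
    also have "\<dots> \<ge> 0" by simp
    finally show ?thesis using C4 by (simp add: zero_le_mult_iff)
  qed
  have "C < 0"
  proof -
    have "C1 + (C2 + C3)\<^sup>2 > 0" using assms(2) by (simp add: add_pos_nonneg)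
    then show ?thesis using C4 unfolding assms(5) by simp
  qed
  from quadratic_nonneg_region[OF this, of "(\<gamma> t0 $ Rad)\<^sup>2" A B] rad_pos[OF assms(8)]
    q_nonneg[OF assms(8)]
  consider (outer) u0 where "u0 > 0" "q u0 = 0" "\<forall>u>0. q u = 0 \<longrightarrow> u \<le> u0"
      "\<forall>u>0. q u \<ge> 0 \<longrightarrow> u0 \<le> u"
    | (between) u1 u2 where "0 < u1" "u1 < u2" "q u1 = 0" "q u2 = 0"
      "\<forall>u>0. q u \<ge> 0 \<longrightarrow> u1 \<le> u \<and> u \<le> u2"
    unfolding q_def by fastforce
  then show ?thesis
  proof cases
    case outer
    have "sqrt u0 > 0" "f (sqrt u0) = 0" using outer by (simp_all add: fq)
    moreover have "r \<le> sqrt u0" if "r > 0" "f r = 0" for r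
      using outer(3) that by (intro real_le_rsqrt) (simp add: fq)
    moreover have "sqrt u0 \<le> \<gamma> t $ Rad" if "t \<in> T" for t
      using outer(4) rad_pos[OF that] q_nonneg[OF that] by (intro real_le_lsqrt) auto
    ultimately show ?thesis by blast
  next
    case between
    have "0 < sqrt u1" "sqrt u1 < sqrt u2" "f (sqrt u1) = 0" "f (sqrt u2) = 0"
      using between by (simp_all add: fq)
    moreover have "sqrt u1 \<le> \<gamma> t $ Rad \<and> \<gamma> t $ Rad \<le> sqrt u2" if "t \<in> T" for t
      using between(1,2,5) rad_pos[OF that] q_nonneg[OF that]
      by (auto intro!: real_le_lsqrt real_le_rsqrt)
    ultimately show ?thesis by blast
  qed
qed

end
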